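(* Let $P$ be the $m\times m$ transition matrix of an aperiodic, irreducible, cyclic Markov chain on an $m$-letter totally ordered alphabet, with first column $(a_1,a_2,\dots,a_m)^T$, i.e. $P_{i,j}=a_{((i-j)\bmod m)+1}$ for $1\le i,j\le m$. For $1\le j\le m$, let $\lambda_j=\sum_{k=1}^m a_k\omega^{(k-1)(j-1)}$, where $\omega=\exp(2\pi i/m)$. Then the asymptotic covariance matrix $\Sigma$ of the chain is a rescaled version (a positive scalar multiple) of the iid uniform covariance matrix $\Sigma_{iidu}:=\frac{m-1}{m^2}M^{(1)}$ if and only if there is a real constant $\gamma$ such that $$\mathrm{Re}\left(\frac{\lambda_j}{1-\lambda_j}\right)=\gamma\qquad\text{for all }2\le j\le m.$$ Moreover, the scaling is then given by $\Sigma=(1+2\gamma)\Sigma_{iidu}$.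
   Context: Here $m\ge2$. $M^{(1)}$ is the $m\times m$ matrix with entries $(M^{(1)})_{k,\ell}=\delta_{k,\ell}-(1-\delta_{k,\ell})/(m-1)$. The asymptotic covariance matrix $\Sigma$ of an irreducible aperiodic chain with transition matrix $P$ and stationary distribution $(\pi_1,\dots,\pi_m)$ (here $\pi_r=1/m$): let $P=S^{-1}\Lambda S$ be a Jordan decomposition of $P$ where the rows of $S$ are generalized left eigenvectors of $P$, the first row of $S$ is $(\pi_1,\dots,\pi_m)$, and $\Lambda=\mathrm{diag}(1,\tilde\Lambda)$ with $\tilde\Lambda$ an $(m-1)\times(m-1)$ lower Jordan-block matrix. Put $D=\mathrm{diag}(-1/2,\tilde\Lambda(I-\tilde\Lambda)^{-1})$, $\Pi=\mathrm{diag}(\pi_1,\dots,\pi_m)$. Then $\Sigma=\Pi+\Pi(S^{-1}DS)+(S^{-1}DS)^T\Pi$. *)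

theory Defs
  imports
    Complex_Main
    "Jordan_Normal_Form.Gauss_Jordan_Elimination"
    "Jordan_Normal_Form.Jordan_Normal_Form"
begin

text \<open>
  A chain on an \<open>m\<close>-letter ordered alphabet is given by its \<open>m\<close> by \<open>m\<close> transition matrix; the
  \<open>r\<close>-th letter in the order is identified with the index \<open>r - 1\<close>, since matrix and vector indices
  start at \<open>0\<close>.
\<close>

definition transition_matrix :: "nat \<Rightarrow> real mat \<Rightarrow> bool" where
  "transition_matrix m P \<longleftrightarrow> P \<in> carrier_mat m m \<and>
     (\<forall>i<m. \<forall>j<m. 0 \<le> P $$ (i,j)) \<and> (\<forall>i<m. (\<Sum>j<m. P $$ (i,j)) = 1)"

definition irreducible_chain :: "real mat \<Rightarrow> bool" where
  "irreducible_chain P \<longleftrightarrow>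
     (\<forall>i<dim_row P. \<forall>j<dim_row P. \<exists>n. 0 < (P ^\<^sub>m n) $$ (i,j))"

definition aperiodic_chain :: "real mat \<Rightarrow> bool" where
  "aperiodic_chain P \<longleftrightarrow>
     (\<forall>i<dim_row P. Gcd {n. 0 < n \<and> 0 < (P ^\<^sub>m n) $$ (i,i)} = 1)"

definition stationary_distribution :: "real mat \<Rightarrow> real vec \<Rightarrow> bool" where
  "stationary_distribution P p \<longleftrightarrow> p \<in> carrier_vec (dim_row P) \<and>
     (\<forall>i<dim_row P. 0 \<le> p $ i) \<and> (\<Sum>i<dim_row P. p $ i) = 1 \<and>
     transpose_mat P *\<^sub>v p = p"

abbreviation block_diag2 :: "'a::zero mat \<Rightarrow> 'a mat \<Rightarrow> 'a mat" where
  "block_diag2 A B \<equiv>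
     four_block_mat A (0\<^sub>m (dim_row A) (dim_col B)) (0\<^sub>m (dim_row B) (dim_col A)) B"

text \<open>Library Jordan blocks are upper triangular, so their transposes are the lower ones.\<close>

definition lower_jordan_matrix :: "complex mat \<Rightarrow> bool" where
  "lower_jordan_matrix L \<longleftrightarrow>
     (\<exists>n_as. 0 \<notin> fst ` set n_as \<and> L = transpose_mat (jordan_matrix n_as))"

text \<open>
  \<open>P = T \<Lambda> S\<close> with \<open>T = S\<^sup>-\<^sup>1\<close> and \<open>\<Lambda> = diag(1, L)\<close>. As \<open>S P = \<Lambda> S\<close> with \<open>\<Lambda>\<close> a lower Jordan
  matrix, the rows of \<open>S\<close> are generalized left eigenvectors of \<open>P\<close>.
\<close>

definition chain_jordan_decomposition ::
  "real mat \<Rightarrow> real vec \<Rightarrow> complex mat \<Rightarrow> complex mat \<Rightarrow> complex mat \<Rightarrow> bool" where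
  "chain_jordan_decomposition P p T S L \<longleftrightarrow>
     lower_jordan_matrix L \<and>
     similar_mat_wit (map_mat complex_of_real P) (block_diag2 (1\<^sub>m 1) L) T S \<and>
     row S 0 = map_vec complex_of_real p"

definition cov_core :: "complex mat \<Rightarrow> complex mat" where
  "cov_core L = block_diag2 (mat 1 1 (\<lambda>_. - 1 / 2))
     (L * the (mat_inverse (1\<^sub>m (dim_row L) - L)))"

definition cov_formula ::
  "real vec \<Rightarrow> complex mat \<Rightarrow> complex mat \<Rightarrow> complex mat \<Rightarrow> complex mat" where
  "cov_formula p T S L =
     (let Pi = mat_diag (dim_vec p) (\<lambda>i. complex_of_real (p $ i)); A = T * cov_core L * S
      in Pi + Pi * A + transpose_mat A * Pi)"

text \<open>
  For an irreducible aperiodic chain, \<open>1\<close> is a simple eigenvalue of \<open>P\<close>, so \<open>I - L\<close> is invertible,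
  and the formula is real and independent of the choice of the Jordan decomposition.
\<close>

definition asymptotic_covariance :: "real mat \<Rightarrow> real mat" where
  "asymptotic_covariance P = (THE Sig. \<exists>p T S L.
     stationary_distribution P p \<and> chain_jordan_decomposition P p T S L \<and>
     map_mat complex_of_real Sig = cov_formula p T S L)"

definition M1 :: "nat \<Rightarrow> real mat" where
  "M1 m = mat m m (\<lambda>(k,l). if k = l then 1 else - 1 / (real m - 1))"

definition Sigma_iidu :: "nat \<Rightarrow> real mat" where
  "Sigma_iidu m = ((real m - 1) / (real m)\<^sup>2) \<cdot>\<^sub>m M1 m"

text \<open>
  The sequence \<open>a\<close> is indexed by \<open>1, \<dots>, m\<close>, while matrix indices start at \<open>0\<close>; the shift cancels
  in the difference \<open>i - j\<close>, which is taken in the integers.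
\<close>

definition cyclic_chain_with :: "nat \<Rightarrow> (nat \<Rightarrow> real) \<Rightarrow> real mat \<Rightarrow> bool" where
  "cyclic_chain_with m a P \<longleftrightarrow>
     (\<forall>i<m. \<forall>j<m. P $$ (i,j) = a (nat ((int i - int j) mod int m) + 1))"

definition cyclic_lambda :: "nat \<Rightarrow> (nat \<Rightarrow> real) \<Rightarrow> nat \<Rightarrow> complex" where
  "cyclic_lambda m a j =
     (\<Sum>k=1..m. complex_of_real (a k) *
        exp (2 * complex_of_real pi * \<i> / of_nat m) ^ ((k - 1) * (j - 1)))"

end

theory Submission
  imports Defs
begin

text \<open>
  For any Jordan decomposition \<open>P = T diag(1, L) S\<close> as in the definition of \<open>\<Sigma>\<close>, the matrix
  \<open>A = T diag(-1/2, L (I - L)\<^sup>-\<^sup>1) S\<close> solves \<open>A (I - P + E) = P - (3/2) E\<close>, where all rows of \<open>E\<close>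
  equal the stationary distribution, and \<open>I - P + E\<close> is invertible. Hence \<open>A\<close> does not depend on
  the decomposition, and for a cyclic chain it can be computed from the one given by the discrete
  Fourier transform: \<open>A\<close> is the circulant matrix with eigenvalues \<open>-1/2\<close> and
  \<open>\<mu>\<^sub>k = \<lambda>\<^sub>k / (1 - \<lambda>\<^sub>k)\<close>. Transposition conjugates the eigenvalues, so \<open>m \<Sigma>\<close> is the circulant
  matrix with eigenvalues \<open>0\<close> and \<open>1 + 2 Re \<mu>\<^sub>k\<close>, whereas \<open>m \<Sigma>\<^sub>i\<^sub>i\<^sub>d\<^sub>u\<close> has eigenvalues
  \<open>0, 1, \<dots>, 1\<close>; now compare eigenvalues. The scaling factor is positive because \<open>|\<lambda>\<^sub>k| < 1\<close> by
  aperiodicity.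
\<close>

section \<open>Independence of the Jordan decomposition\<close>

abbreviation bordered :: "complex \<Rightarrow> complex mat \<Rightarrow> complex mat" where
  "bordered c X \<equiv> block_diag2 (mat 1 1 (\<lambda>_. c)) X"

lemma bordered_mult:
  assumes "X \<in> carrier_mat n n" "Y \<in> carrier_mat n n"
  shows "bordered c X * bordered d Y = bordered (c * d) (X * Y)"
proof -
  have "bordered c X * bordered d Y = four_block_mat
      (mat 1 1 (\<lambda>_. c) * mat 1 1 (\<lambda>_. d) + 0\<^sub>m 1 n * 0\<^sub>m n 1)
      (mat 1 1 (\<lambda>_. c) * 0\<^sub>m 1 n + 0\<^sub>m 1 n * Y)
      (0\<^sub>m n 1 * mat 1 1 (\<lambda>_. d) + X * 0\<^sub>m n 1)
      (0\<^sub>m n 1 * 0\<^sub>m 1 n + X * Y)"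
    using assms by (subst mult_four_block_mat[of _ 1 1 _ n _ n _ _ 1 _ n]) auto
  also have "\<dots> = bordered (c * d) (X * Y)"
    by (rule eq_matI) (use assms in \<open>auto simp: scalar_prod_def\<close>)
  finally show ?thesis .
qed

lemma resolvent_eq_bordered:
  assumes "X \<in> carrier_mat n n"
  shows "1\<^sub>m (Suc n) - bordered 1 X + bordered 1 (0\<^sub>m n n) = bordered 1 (1\<^sub>m n - X)"
  by (rule eq_matI) (use assms in auto)

lemma mult_bordered_zero:
  assumes "X \<in> carrier_mat (Suc n) (Suc n)" "Y \<in> carrier_mat (Suc n) (Suc n)"
    and "i < Suc n" "j < Suc n"
  shows "(X * bordered c (0\<^sub>m n n) * Y) $$ (i, j) = X $$ (i, 0) * c * Y $$ (0, j)"
proof -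
  have "bordered c (0\<^sub>m n n) = mat_diag (Suc n) (\<lambda>k. if k = 0 then c else 0)"
    by (rule eq_matI) (auto simp: mat_diag_def)
  then have "X * bordered c (0\<^sub>m n n) * Y
      = mat (Suc n) (Suc n) (\<lambda>(i,j). X $$ (i,j) * (if j = 0 then c else 0)) * Y"
    using assms by (simp add: mat_diag_mult_right)
  then show ?thesis
    using assms by (simp add: scalar_prod_def sum.atLeast0_lessThan_Suc_shift del: sum.op_ivl_Suc)
qed

lemma mat_inverse_of_kernel_trivial:
  fixes A :: "'a::field mat"
  assumes A: "A \<in> carrier_mat n n"
    and ker: "\<And>v. v \<in> carrier_vec n \<Longrightarrow> transpose_mat A *\<^sub>v v = 0\<^sub>v n \<Longrightarrow> v = 0\<^sub>v n"
  shows "the (mat_inverse A) \<in> carrier_mat n n"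
    "A * the (mat_inverse A) = 1\<^sub>m n" "the (mat_inverse A) * A = 1\<^sub>m n"
proof -
  have "det (transpose_mat A) \<noteq> 0"
    using ker A det_0_iff_vec_prod_zero_field[of "transpose_mat A" n] by auto
  then have "det A \<noteq> 0" using det_transpose[OF A] by simp
  from det_non_zero_imp_unit[OF A this, of "()"] have "mat_inverse A \<noteq> None"
    using mat_inverse(1)[OF A, of "()"] by blast
  then obtain B where "mat_inverse A = Some B" by blast
  with mat_inverse(2)[OF A this] show "the (mat_inverse A) \<in> carrier_mat n n"
    "A * the (mat_inverse A) = 1\<^sub>m n" "the (mat_inverse A) * A = 1\<^sub>m n" by auto
qed

context
  fixes n :: nat and S T :: "complex mat"
  assumes S: "S \<in> carrier_mat n n" and T: "T \<in> carrier_mat n n"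
    and ST: "S * T = 1\<^sub>m n"
begin

lemma conjugate_mult:
  assumes "X \<in> carrier_mat n n" "Y \<in> carrier_mat n n"
  shows "(T * X * S) * (T * Y * S) = T * (X * Y) * S"
proof -
  have "(T * X * S) * (T * Y * S) = T * X * (S * T) * Y * S"
    using assms S T by (simp add: assoc_mult_mat[of _ n n _ n _ n])
  also have "\<dots> = T * (X * Y) * S"
    unfolding ST using assms S T by (simp add: assoc_mult_mat[of _ n n _ n _ n])
  finally show ?thesis .
qed

lemma conjugate_add:
  assumes "X \<in> carrier_mat n n" "Y \<in> carrier_mat n n"
  shows "T * X * S + T * Y * S = T * (X + Y) * S"
  using assms S T
  by (simp add: mult_add_distrib_mat[of _ n n _ n] add_mult_distrib_mat[of _ n n _ _ n])

lemma conjugate_minus: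
  assumes "X \<in> carrier_mat n n" "Y \<in> carrier_mat n n"
  shows "T * X * S - T * Y * S = T * (X - Y) * S"
  using assms S T
  by (simp add: mult_minus_distrib_mat[of _ n n _ n] minus_mult_distrib_mat[of _ n n _ _ n])

end

definition stationary_projection :: "real vec \<Rightarrow> complex mat" where
  "stationary_projection p =
     mat (dim_vec p) (dim_vec p) (\<lambda>(i,j). complex_of_real (p $ j))"

lemma fixed_bordered_transpose:
  assumes "X \<in> carrier_mat n n" "v \<in> carrier_vec n" "transpose_mat X *\<^sub>v v = v"
  shows "transpose_mat (bordered 1 X) *\<^sub>v (0\<^sub>v 1 @\<^sub>v v) = 0\<^sub>v 1 @\<^sub>v v"
proof -
  have "transpose_mat (bordered 1 X)
      = four_block_mat (1\<^sub>m 1) (0\<^sub>m 1 n) (0\<^sub>m n 1) (transpose_mat X)"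
    by (rule eq_matI) (use assms in auto)
  moreover have "\<dots> *\<^sub>v (0\<^sub>v 1 @\<^sub>v v) = 1\<^sub>m 1 *\<^sub>v 0\<^sub>v 1 @\<^sub>v transpose_mat X *\<^sub>v v"
    by (rule mult_mat_vec_split) (use assms in auto)
  ultimately show ?thesis using assms by simp
qed

lemma mult_ones_vec:
  assumes "A \<in> carrier_mat n n" "\<And>i. i < n \<Longrightarrow> (\<Sum>j<n. A $$ (i,j)) = (1::'a::semiring_1)"
  shows "A *\<^sub>v vec n (\<lambda>_. 1) = vec n (\<lambda>_. 1)"
  by (rule eq_vecI) (use assms in \<open>auto simp: scalar_prod_def lessThan_atLeast0\<close>)

lemma decomposition_inverse:
  fixes P :: "real mat"
  assumes P: "transition_matrix (Suc n) P"
    and p: "p \<in> carrier_vec (Suc n)"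
    and dec: "chain_jordan_decomposition P p T S L"
    and fixed: "\<forall>u\<in>carrier_vec (Suc n). transpose_mat (map_mat complex_of_real P) *\<^sub>v u = u
      \<longrightarrow> (\<exists>c. u = c \<cdot>\<^sub>v map_vec complex_of_real p)"
  defines "N \<equiv> the (mat_inverse (1\<^sub>m n - L))"
  shows "L \<in> carrier_mat n n" "N \<in> carrier_mat n n" "(1\<^sub>m n - L) * N = 1\<^sub>m n" "N * (1\<^sub>m n - L) = 1\<^sub>m n"
    and "cov_core L = bordered (-1/2) (L * N)"
proof -
  let ?Q = "map_mat complex_of_real P"
  have Q: "?Q \<in> carrier_mat (Suc n) (Suc n)" using P by (auto simp: transition_matrix_def)
  have one: "(1\<^sub>m 1 :: complex mat) = mat 1 1 (\<lambda>_. 1)" by (rule eq_matI) auto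
  have sim: "similar_mat_wit ?Q (bordered 1 L) T S"
    and row: "row S 0 = map_vec complex_of_real p"
    using dec[unfolded chain_jordan_decomposition_def one] by blast+
  define B where "B = bordered 1 L"
  note D = similar_mat_witD2[OF Q sim, folded B_def]
  have "dim_row L = n" using carrier_matD(1)[OF D(5)] by (simp add: B_def)
  moreover have "dim_col L = n" using carrier_matD(2)[OF D(5)] by (simp add: B_def)
  ultimately show L: "L \<in> carrier_mat n n" by (rule carrier_matI)
  have QT: "transpose_mat ?Q = transpose_mat S * (transpose_mat B * transpose_mat T)"
    using D(5-7) by (simp add: D(3) transpose_mult[of _ "Suc n" "Suc n" _ "Suc n"])
  have ker: "v = 0\<^sub>v n" if v: "v \<in> carrier_vec n" and "transpose_mat (1\<^sub>m n - L) *\<^sub>v v = 0\<^sub>v n" for v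
  proof -
    have "transpose_mat L *\<^sub>v v = v"
    proof -
      have "transpose_mat (1\<^sub>m n - L) = 1\<^sub>m n - transpose_mat L"
        by (rule eq_matI) (use L in auto)
      then have "0\<^sub>v n = v - transpose_mat L *\<^sub>v v"
        using that L by (simp add: minus_mult_distrib_mat_vec[of _ n n])
      then show ?thesis using v L
        by (metis (no_types, lifting) eq_vecI index_minus_vec(1) index_zero_vec(1) right_minus_eq
            carrier_vecD carrier_matD dim_mult_mat_vec index_transpose_mat(2))
    qed
    define w where "w = 0\<^sub>v 1 @\<^sub>v v"
    define u where "u = transpose_mat S *\<^sub>v w"
    have w: "w \<in> carrier_vec (Suc n)"
      using v append_carrier_vec[of "0\<^sub>v 1" 1 v n] by (simp add: w_def)
    have "transpose_mat T *\<^sub>v u = w"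
    proof -
      have "transpose_mat T *\<^sub>v u = transpose_mat (S * T) *\<^sub>v w"
        using D(6,7) w by (simp add: u_def transpose_mult[of _ "Suc n" "Suc n" _ "Suc n"])
      then show ?thesis using w by (simp add: D(2))
    qed
    moreover have "transpose_mat B *\<^sub>v w = w"
      unfolding w_def B_def by (rule fixed_bordered_transpose) fact+
    moreover have u: "u \<in> carrier_vec (Suc n)" using D(7) w by (simp add: u_def)
    ultimately have "transpose_mat ?Q *\<^sub>v u = u"
      unfolding QT using D(5-7) by (simp add: u_def[symmetric] assoc_mult_mat_vec[of _ "Suc n" "Suc n" _ "Suc n"])
    with fixed u obtain c where c: "u = c \<cdot>\<^sub>v row S 0" by (auto simp: row)
    have row0: "row S 0 \<in> carrier_vec (Suc n)" using D(7) by (intro carrier_vecI) simp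
    have "w = c \<cdot>\<^sub>v unit_vec (Suc n) 0"
    proof -
      have "transpose_mat T *\<^sub>v row S 0 = unit_vec (Suc n) 0"
      proof (rule eq_vecI)
        fix i assume i: "i < dim_vec (unit_vec (Suc n) 0)"
        then have "(transpose_mat T *\<^sub>v row S 0) $ i = (S * T) $$ (0, i)"
          using D(6,7) by (simp add: comm_scalar_prod[OF col_carrier_vec[OF _ D(6)] row0])
        with i show "(transpose_mat T *\<^sub>v row S 0) $ i = unit_vec (Suc n) 0 $ i"
          by (simp add: D(2))
      qed (use D(6) in simp)
      with \<open>transpose_mat T *\<^sub>v u = w\<close> show ?thesis
        using D(6) row0 by (simp add: c mult_mat_vec[of _ "Suc n" "Suc n"])
    qed
    then have *: "w $ i = (c \<cdot>\<^sub>v unit_vec (Suc n) 0) $ i" for i by simp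
    show ?thesis
    proof (rule eq_vecI)
      fix i assume "i < dim_vec (0\<^sub>v n)"
      with *[of "Suc i"] v show "v $ i = 0\<^sub>v n $ i" by (simp add: w_def)
    qed (use v in simp)
  qed
  have "1\<^sub>m n - L \<in> carrier_mat n n" using L by auto
  note inv = mat_inverse_of_kernel_trivial[OF this ker]
  show N: "N \<in> carrier_mat n n" "(1\<^sub>m n - L) * N = 1\<^sub>m n" "N * (1\<^sub>m n - L) = 1\<^sub>m n"
    unfolding N_def by (rule inv; assumption)+
  show "cov_core L = bordered (-1/2) (L * N)"
    using L by (simp add: cov_core_def N_def)
qed

lemma decomposition_projection:
  assumes P: "transition_matrix (Suc n) P"
    and p: "stationary_distribution P p"
    and dec: "chain_jordan_decomposition P p T S L"
    and fixed: "\<forall>u\<in>carrier_vec (Suc n). transpose_mat (map_mat complex_of_real P) *\<^sub>v u = u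
      \<longrightarrow> (\<exists>c. u = c \<cdot>\<^sub>v map_vec complex_of_real p)"
  shows "T * bordered 1 (0\<^sub>m n n) * S = stationary_projection p"
proof -
  let ?Q = "map_mat complex_of_real P"
  let ?e = "vec (Suc n) (\<lambda>_. 1) :: complex vec"
  have Q: "?Q \<in> carrier_mat (Suc n) (Suc n)" using P by (auto simp: transition_matrix_def)
  have one: "(1\<^sub>m 1 :: complex mat) = mat 1 1 (\<lambda>_. 1)" by (rule eq_matI) auto
  have sim: "similar_mat_wit ?Q (bordered 1 L) T S"
    and row: "row S 0 = map_vec complex_of_real p"
    using dec[unfolded chain_jordan_decomposition_def one] by blast+
  define B where "B = bordered 1 L"
  note D = similar_mat_witD2[OF Q sim, folded B_def]
  have pc: "p \<in> carrier_vec (Suc n)" and p1: "(\<Sum>i<Suc n. p $ i) = 1"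
    using p P by (auto simp: stationary_distribution_def transition_matrix_def)
  note I = decomposition_inverse[OF P pc dec fixed]
  have L: "L \<in> carrier_mat n n" by (rule I(1))
  define y where "y = S *\<^sub>v ?e"
  have y: "y \<in> carrier_vec (Suc n)" using D(7) by (simp add: y_def)
  have Te: "T *\<^sub>v y = ?e"
  proof -
    have "T *\<^sub>v y = (T * S) *\<^sub>v ?e" using D(6,7) by (simp add: y_def)
    then show ?thesis by (simp add: D(1))
  qed
  have "?Q *\<^sub>v ?e = ?e"
  proof (rule mult_ones_vec[OF Q])
    fix i assume i: "i < Suc n"
    then have "(\<Sum>j<Suc n. ?Q $$ (i,j)) = (\<Sum>j<Suc n. complex_of_real (P $$ (i,j)))"
      using Q by (intro sum.cong) auto
    also have "\<dots> = complex_of_real (\<Sum>j<Suc n. P $$ (i,j))" by (simp only: of_real_sum)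
    also have "(\<Sum>j<Suc n. P $$ (i,j)) = 1" using P i unfolding transition_matrix_def by blast
    finally show "(\<Sum>j<Suc n. ?Q $$ (i,j)) = 1" by simp
  qed
  have "B *\<^sub>v y = y"
  proof -
    have "S * ?Q = B * S"
    proof -
      have "S * ?Q = (S * T) * B * S"
        using D(5-7) by (simp add: D(3) assoc_mult_mat[of _ "Suc n" "Suc n" _ "Suc n" _ "Suc n"])
      then show ?thesis using D(5,7) by (simp add: D(2))
    qed
    moreover have "(S * ?Q) *\<^sub>v ?e = S *\<^sub>v (?Q *\<^sub>v ?e)"
      by (rule assoc_mult_mat_vec[OF D(7) Q]) simp
    moreover have "B *\<^sub>v y = (B * S) *\<^sub>v ?e"
      unfolding y_def by (subst assoc_mult_mat_vec[of _ "Suc n" "Suc n" _ "Suc n"]) (use D(5,7) in auto)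
    ultimately have "B *\<^sub>v y = S *\<^sub>v (?Q *\<^sub>v ?e)"
      by (simp only:)
    then show ?thesis by (simp add: \<open>?Q *\<^sub>v ?e = ?e\<close> y_def)
  qed
  define z where "z = vec n (\<lambda>i. y $ Suc i)"
  have z: "z \<in> carrier_vec n" by (simp add: z_def)
  have y_split: "y = vec 1 (\<lambda>_. y $ 0) @\<^sub>v z"
    by (rule eq_vecI) (use y in \<open>auto simp: z_def\<close>)
  have "B *\<^sub>v (vec 1 (\<lambda>_. y $ 0) @\<^sub>v z)
      = mat 1 1 (\<lambda>_. 1) *\<^sub>v vec 1 (\<lambda>_. y $ 0) @\<^sub>v L *\<^sub>v z"
    using mult_mat_vec_split[of "mat 1 1 (\<lambda>_. 1)" 1 L n "vec 1 (\<lambda>_. y $ 0)" z] L z by (simp add: B_def)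
  also have "mat 1 1 (\<lambda>_. 1) *\<^sub>v vec 1 (\<lambda>_. y $ 0) = vec 1 (\<lambda>_. y $ 0)"
    by (rule eq_vecI) (auto simp: scalar_prod_def)
  finally have "vec 1 (\<lambda>_. y $ 0) @\<^sub>v L *\<^sub>v z
      = vec 1 (\<lambda>_. y $ 0) @\<^sub>v z"
    using \<open>B *\<^sub>v y = y\<close> by (simp only: y_split[symmetric])
  then have "L *\<^sub>v z = z"
    by (subst (asm) append_vec_eq[of _ 1]) auto
  then have "(1\<^sub>m n - L) *\<^sub>v z = 0\<^sub>v n"
    using L z by (simp add: minus_mult_distrib_mat_vec[of _ n n])
  then have "(the (mat_inverse (1\<^sub>m n - L)) * (1\<^sub>m n - L)) *\<^sub>v z = the (mat_inverse (1\<^sub>m n - L)) *\<^sub>v 0\<^sub>v n"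
    using I(2) L z by (subst assoc_mult_mat_vec[of _ n n _ n]) auto
  also have "\<dots> = 0\<^sub>v n" by (rule eq_vecI) (use I(2) in auto)
  finally have "z = 0\<^sub>v n" using z by (simp add: I(4))
  moreover have "y $ 0 = 1"
  proof -
    have "y $ 0 = row S 0 \<bullet> ?e" using D(7) by (simp add: y_def)
    also have "\<dots> = complex_of_real (\<Sum>i<Suc n. p $ i)"
      using pc by (simp add: row scalar_prod_def lessThan_atLeast0)
    finally show ?thesis by (simp only: p1 of_real_1)
  qed
  ultimately have "y = unit_vec (Suc n) 0"
    by (subst y_split) (rule eq_vecI, auto)
  then have T0: "T $$ (i, 0) = 1" if "i < Suc n" for i
  proof -
    have "T $$ (i, 0) = (T *\<^sub>v unit_vec (Suc n) 0) $ i"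
      using D(6) that by (simp add: scalar_prod_right_unit[of _ "Suc n"])
    then show ?thesis using that by (simp add: \<open>y = unit_vec (Suc n) 0\<close>[symmetric] Te)
  qed
  show ?thesis
  proof (rule eq_matI)
    fix i j assume "i < dim_row (stationary_projection p)" "j < dim_col (stationary_projection p)"
    then have ij: "i < Suc n" "j < Suc n" using pc by (auto simp: stationary_projection_def)
    have "S $$ (0, j) = row S 0 $ j" using D(7) ij by simp
    also have "\<dots> = complex_of_real (p $ j)" using pc ij by (simp add: row)
    finally show "(T * bordered 1 (0\<^sub>m n n) * S) $$ (i, j) = stationary_projection p $$ (i, j)"
      unfolding mult_bordered_zero[OF D(6,7) ij] using ij pc by (simp add: T0 stationary_projection_def)
  qed (use D(6,7) pc in \<open>auto simp: stationary_projection_def\<close>)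
qed

lemma decomposition_core_characterization:
  assumes P: "transition_matrix (Suc n) P"
    and p: "stationary_distribution P p"
    and dec: "chain_jordan_decomposition P p T S L"
    and fixed: "\<forall>u\<in>carrier_vec (Suc n). transpose_mat (map_mat complex_of_real P) *\<^sub>v u = u
      \<longrightarrow> (\<exists>c. u = c \<cdot>\<^sub>v map_vec complex_of_real p)"
  defines "G \<equiv> 1\<^sub>m (Suc n) - map_mat complex_of_real P + stationary_projection p"
  shows "T * cov_core L * S \<in> carrier_mat (Suc n) (Suc n)"
    and "T * cov_core L * S * G = map_mat complex_of_real P - (3/2) \<cdot>\<^sub>m stationary_projection p"
    and "\<exists>R\<in>carrier_mat (Suc n) (Suc n). G * R = 1\<^sub>m (Suc n)"
proof -
  let ?Q = "map_mat complex_of_real P"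
  let ?N = "the (mat_inverse (1\<^sub>m n - L))"
  have Q: "?Q \<in> carrier_mat (Suc n) (Suc n)" using P by (auto simp: transition_matrix_def)
  have pc: "p \<in> carrier_vec (Suc n)"
    using p P by (auto simp: stationary_distribution_def transition_matrix_def)
  note I = decomposition_inverse[OF P pc dec fixed]
  note L = I(1)
  have one: "(1\<^sub>m 1 :: complex mat) = mat 1 1 (\<lambda>_. 1)" by (rule eq_matI) auto
  have sim: "similar_mat_wit ?Q (bordered 1 L) T S"
    using dec[unfolded chain_jordan_decomposition_def one] by blast
  note D = similar_mat_witD2[OF Q sim]
  note conj = conjugate_mult[OF D(7,6,2)] conjugate_add[OF D(7,6,2)] conjugate_minus[OF D(7,6,2)]
  have carr: "bordered c X \<in> carrier_mat (Suc n) (Suc n)" if "X \<in> carrier_mat n n" for c X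
    using that four_block_carrier_mat[of "mat 1 1 (\<lambda>_. c)" 1 1 X n n] by simp
  have E: "stationary_projection p = T * bordered 1 (0\<^sub>m n n) * S"
    using decomposition_projection[OF P p dec fixed] by simp
  have BL: "bordered 1 L \<in> carrier_mat (Suc n) (Suc n)" using carr L by blast
  have B0: "bordered 1 (0\<^sub>m n n) \<in> carrier_mat (Suc n) (Suc n)" by (rule carr) simp
  have T1S: "T * 1\<^sub>m (Suc n) * S = 1\<^sub>m (Suc n)" using D(1,6,7) by simp
  have "1\<^sub>m (Suc n) - ?Q = T * (1\<^sub>m (Suc n) - bordered 1 L) * S"
    using conj(3)[OF one_carrier_mat BL] unfolding T1S D(3)[symmetric] .
  then have "G = T * (1\<^sub>m (Suc n) - bordered 1 L + bordered 1 (0\<^sub>m n n)) * S"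
    unfolding G_def E by (simp only: conj(2)[OF minus_carrier_mat[OF BL] B0])
  then have G: "G = T * bordered 1 (1\<^sub>m n - L) * S"
    by (simp only: resolvent_eq_bordered[OF L])
  show "T * cov_core L * S \<in> carrier_mat (Suc n) (Suc n)"
    using D(6,7) I(2) L carr[of "L * ?N" "-1/2"] by (simp add: I(5))
  have "T * cov_core L * S * G = T * (bordered (-1/2) (L * ?N) * bordered 1 (1\<^sub>m n - L)) * S"
    unfolding G I(5) using carr L I(2) by (intro conj(1)) auto
  also have "bordered (-1/2) (L * ?N) * bordered 1 (1\<^sub>m n - L) = bordered (-1/2) L"
  proof -
    have "L * ?N * (1\<^sub>m n - L) = L"
      using L I(2) by (subst assoc_mult_mat[of _ n n _ n _ n]) (auto simp: I(4))
    then show ?thesis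
      using I(2) by (simp only: bordered_mult[OF mult_carrier_mat[OF L I(2)] minus_carrier_mat[OF L]] mult_1_right)
  qed
  also have "bordered (-1/2) L = bordered 1 L - (3/2) \<cdot>\<^sub>m bordered 1 (0\<^sub>m n n)"
    by (rule eq_matI) (use L in auto)
  also have "T * \<dots> * S = T * bordered 1 L * S - (T * ((3/2) \<cdot>\<^sub>m bordered 1 (0\<^sub>m n n)) * S)"
    using carr L by (subst conj(3)) auto
  also have "T * ((3/2) \<cdot>\<^sub>m bordered 1 (0\<^sub>m n n)) * S = (3/2) \<cdot>\<^sub>m (T * bordered 1 (0\<^sub>m n n) * S)"
    using D(6,7) carr[of "0\<^sub>m n n" 1] by (simp add: mult_smult_distrib[of _ "Suc n" "Suc n" _ "Suc n"]
        mult_smult_assoc_mat[of _ "Suc n" "Suc n" _ "Suc n"])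
  finally show "T * cov_core L * S * G = ?Q - (3/2) \<cdot>\<^sub>m stationary_projection p"
    by (simp only: E D(3))
  show "\<exists>R\<in>carrier_mat (Suc n) (Suc n). G * R = 1\<^sub>m (Suc n)"
  proof
    have "G * (T * bordered 1 ?N * S) = T * (bordered 1 (1\<^sub>m n - L) * bordered 1 ?N) * S"
      unfolding G using carr L I(2) by (intro conj(1)) auto
    also have "bordered 1 (1\<^sub>m n - L) * bordered 1 ?N = 1\<^sub>m (Suc n)"
      using L I(2,3) by (subst bordered_mult[of _ n]) (auto intro!: eq_matI)
    finally show "G * (T * bordered 1 ?N * S) = 1\<^sub>m (Suc n)" using D(1,6) by simp
    show "T * bordered 1 ?N * S \<in> carrier_mat (Suc n) (Suc n)"
      using D(6,7) I(2) carr[of ?N 1] by simp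
  qed
qed

lemma cov_core_unique:
  assumes P: "transition_matrix (Suc n) P"
    and p: "stationary_distribution P p"
    and fixed: "\<forall>u\<in>carrier_vec (Suc n). transpose_mat (map_mat complex_of_real P) *\<^sub>v u = u
      \<longrightarrow> (\<exists>c. u = c \<cdot>\<^sub>v map_vec complex_of_real p)"
    and dec: "chain_jordan_decomposition P p T S L" "chain_jordan_decomposition P p T' S' L'"
  shows "T * cov_core L * S = T' * cov_core L' * S'"
proof -
  let ?A = "T * cov_core L * S" and ?A' = "T' * cov_core L' * S'"
  let ?G = "1\<^sub>m (Suc n) - map_mat complex_of_real P + stationary_projection p"
  note C = decomposition_core_characterization[OF P p dec(1) fixed]
  note C' = decomposition_core_characterization[OF P p dec(2) fixed]
  obtain R where R: "R \<in> carrier_mat (Suc n) (Suc n)" "?G * R = 1\<^sub>m (Suc n)"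
    using C(3) by blast
  have G: "?G \<in> carrier_mat (Suc n) (Suc n)"
    using P p by (auto simp: transition_matrix_def stationary_projection_def stationary_distribution_def)
  have "?A = ?A * ?G * R"
    by (simp only: assoc_mult_mat[OF C(1) G R(1)] R(2) right_mult_one_mat[OF C(1)])
  also have "\<dots> = ?A' * ?G * R" by (simp only: C(2) C'(2))
  also have "\<dots> = ?A'"
    by (simp only: assoc_mult_mat[OF C'(1) G R(1)] R(2) right_mult_one_mat[OF C'(1)])
  finally show ?thesis .
qed

section \<open>Circulant matrices\<close>

lemma unit_mult_cnj: "cmod z = 1 \<Longrightarrow> z * cnj z = 1"
  by (simp flip: complex_norm_square)

lemma cis_root_power:
  "cis (2 * pi / real m) ^ k = cis (2 * pi * real k / real m)"
  by (simp add: Complex.DeMoivre field_simps)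

lemma cis_root_power_self: "0 < m \<Longrightarrow> cis (2 * pi / real m) ^ m = 1"
  by (simp add: cis_root_power)

lemma cis_root_power_inj:
  assumes "k < m" "l < m" "cis (2 * pi / real m) ^ k = cis (2 * pi / real m) ^ l"
  shows "k = l"
  using bij_betw_roots_unity[of m] assms
  by (auto simp: bij_betw_def inj_on_def cis_root_power)

lemma power_mod_of_power_eq_1:
  fixes z :: "'a::monoid_mult"
  assumes "z ^ m = 1"
  shows "z ^ (k mod m) = z ^ k"
proof -
  have "z ^ k = z ^ (m * (k div m) + k mod m)" by simp
  also have "\<dots> = z ^ (k mod m)" unfolding power_add power_mult assms by simp
  finally show ?thesis ..
qed

definition dft :: "nat \<Rightarrow> complex mat" where
  "dft m = mat m m (\<lambda>(k,j). cis (2 * pi / real m) ^ (k * j) / of_nat m)"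

definition idft :: "nat \<Rightarrow> complex mat" where
  "idft m = mat m m (\<lambda>(i,k). cnj (cis (2 * pi / real m) ^ (i * k)))"

lemma dft_carrier [simp]: "dft m \<in> carrier_mat m m"
  and idft_carrier [simp]: "idft m \<in> carrier_mat m m"
  by (simp_all add: dft_def idft_def)

lemma dft_idft: "dft m * idft m = 1\<^sub>m m"
proof (rule eq_matI)
  fix k l assume "k < dim_row (1\<^sub>m m :: complex mat)" "l < dim_col (1\<^sub>m m :: complex mat)"
  then have kl: "k < m" "l < m" by auto
  let ?w = "cis (2 * pi / real m)"
  define z where "z = ?w ^ k * cnj (?w ^ l)"
  have unit: "?w ^ l * cnj (?w ^ l) = 1"
    by (rule unit_mult_cnj) (simp add: norm_power)
  have "z ^ j = ?w ^ (k * j) * cnj (?w ^ (j * l))" for j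
    by (simp add: z_def power_mult_distrib mult.commute[of j l] power_mult)
  then have "(dft m * idft m) $$ (k,l) = (\<Sum>j<m. z ^ j / of_nat m)"
    using kl by (simp add: dft_def idft_def scalar_prod_def lessThan_atLeast0)
  also have "\<dots> = (\<Sum>j<m. z ^ j) / of_nat m" by (simp add: sum_divide_distrib)
  also have "\<dots> = (if k = l then 1 else 0)"
  proof (cases "k = l")
    case True
    then show ?thesis using kl unit by (simp add: z_def)
  next
    case False
    have "z ^ m = (?w ^ m) ^ k * cnj ((?w ^ m) ^ l)"
      by (simp add: z_def power_mult_distrib flip: power_mult) (simp add: mult.commute)
    then have "z ^ m = 1" using kl by (simp add: cis_root_power_self)
    moreover have "z \<noteq> 1"
    proof
      assume "z = 1"
      then have "?w ^ k * (cnj (?w ^ l) * ?w ^ l) = ?w ^ l" by (simp add: z_def flip: mult.assoc)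
      then have "?w ^ k = ?w ^ l" using unit by (simp only: mult.commute[of "cnj (?w ^ l)"] mult_1_right)
      with False kl show False using cis_root_power_inj by blast
    qed
    ultimately show ?thesis using False by (simp add: geometric_sum)
  qed
  finally show "(dft m * idft m) $$ (k,l) = 1\<^sub>m m $$ (k,l)" using kl by simp
qed (auto simp: dft_def idft_def)

lemma idft_dft: "idft m * dft m = 1\<^sub>m m"
  by (rule mat_mult_left_right_inverse[OF _ _ dft_idft]) simp_all

definition circulant :: "nat \<Rightarrow> (nat \<Rightarrow> complex) \<Rightarrow> complex mat" where
  "circulant m g = idft m * mat_diag m g * dft m"

lemma circulant_carrier [simp]: "circulant m g \<in> carrier_mat m m"
  unfolding circulant_def by (intro mult_carrier_mat[of _ m m]) simp_all

lemma circulant_index: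
  assumes "i < m" "j < m"
  shows "circulant m g $$ (i,j) =
    (\<Sum>k<m. g k * (cis (2 * pi / real m) ^ (k * j) * cnj (cis (2 * pi / real m) ^ (k * i)))) / of_nat m"
  using assms unfolding circulant_def
  by (subst mat_diag_mult_right[of _ m])
    (auto simp: dft_def idft_def scalar_prod_def lessThan_atLeast0 sum_divide_distrib mult_ac
      intro!: sum.cong)

lemma circulant_one: "circulant m (\<lambda>_. 1) = 1\<^sub>m m"
  unfolding circulant_def using right_mult_one_mat[OF idft_carrier[of m]] by (simp add: idft_dft)

lemma dft_circulant: "dft m * circulant m g = mat_diag m g * dft m"
proof -
  have "dft m * circulant m g = dft m * idft m * (mat_diag m g * dft m)"
    by (simp add: circulant_def assoc_mult_mat[of _ m m _ m _ m] mult_carrier_mat[of _ m m])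
  then show ?thesis by (simp add: dft_idft left_mult_one_mat[of _ m m] mult_carrier_mat[of _ m m])
qed

lemma circulant_idft: "circulant m g * idft m = idft m * mat_diag m g"
proof -
  have "circulant m g * idft m = idft m * mat_diag m g * (dft m * idft m)"
    unfolding circulant_def
    by (rule assoc_mult_mat[of _ m m _ m _ m]) (simp_all add: mult_carrier_mat[of _ m m])
  then show ?thesis by (simp add: dft_idft right_mult_one_mat[of _ m m] mult_carrier_mat[of _ m m])
qed

lemma circulant_inj:
  assumes "circulant m f = circulant m g" "k < m"
  shows "f k = g k"
proof -
  have "dft m * circulant m h * idft m = mat_diag m h" for h
    unfolding dft_circulant
    by (subst assoc_mult_mat[of _ m m _ m _ m]) (simp_all add: dft_idft right_mult_one_mat[of _ m m])
  from this[of f] this[of g] have "mat_diag m f = mat_diag m g" by (simp add: assms)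
  then have "mat_diag m f $$ (k,k) = mat_diag m g $$ (k,k)" by simp
  then show ?thesis using assms(2) by (simp add: mat_diag_def)
qed

lemma circulant_cong: "(\<And>k. k < m \<Longrightarrow> f k = g k) \<Longrightarrow> circulant m f = circulant m g"
  by (rule eq_matI) (auto simp: circulant_index carrier_matD[OF circulant_carrier] intro!: sum.cong)

lemma cnj_circulant:
  assumes "i < m" "j < m"
  shows "cnj (circulant m g $$ (j,i)) = circulant m (\<lambda>k. cnj (g k)) $$ (i,j)"
  using assms by (simp add: circulant_index mult_ac)

lemma root_power_reflect:
  assumes m: "0 < m" and "k \<le> m"
  shows "cis (2 * pi / real m) ^ ((m - k) * i) = cnj (cis (2 * pi / real m) ^ (k * i))"
proof -
  let ?w = "cis (2 * pi / real m)"
  have "?w ^ ((m - k) * i) * ?w ^ (k * i) = (?w ^ m) ^ i"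
    using assms(2) by (simp flip: power_add power_mult distrib_right)
  also have "\<dots> = 1" using m by (simp add: cis_root_power_self)
  finally have *: "?w ^ ((m - k) * i) * ?w ^ (k * i) = 1" .
  have "?w ^ (k * i) * cnj (?w ^ (k * i)) = 1"
    by (rule unit_mult_cnj) (simp add: norm_power)
  with * show ?thesis by (metis mult.assoc mult_1_left mult_1_right)
qed

lemma circulant_swap:
  assumes ij: "i < m" "j < m" and refl: "\<And>k. 0 < k \<Longrightarrow> k < m \<Longrightarrow> g (m - k) = h k" "g 0 = h 0"
  shows "circulant m g $$ (j,i) = circulant m h $$ (i,j)"
proof -
  let ?w = "cis (2 * pi / real m)"
  have m: "0 < m" using ij by auto
  have refl_pow: "?w ^ ((m - k) * i) = cnj (?w ^ (k * i))" if "k \<le> m" for k i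
    using root_power_reflect[OF m that] .
  have split: "(\<Sum>k<m. f k) = f 0 + (\<Sum>k\<in>{1..<m}. f k)" for f :: "nat \<Rightarrow> complex"
    using m by (simp add: lessThan_atLeast0 sum.atLeast_Suc_lessThan)
  have "(\<Sum>k\<in>{1..<m}. g k * (?w ^ (k * i) * cnj (?w ^ (k * j))))
      = (\<Sum>k\<in>{1..<m}. h k * (?w ^ (k * j) * cnj (?w ^ (k * i))))"
  proof (rule sum.reindex_bij_witness[of _ "\<lambda>k. m - k" "\<lambda>k. m - k"])
    fix k assume "k \<in> {1..<m}"
    then show "h (m - k) * (?w ^ ((m - k) * j) * cnj (?w ^ ((m - k) * i)))
        = g k * (?w ^ (k * i) * cnj (?w ^ (k * j)))"
      using refl(1)[of "m - k"] refl_pow[of k] by simp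
  qed auto
  then show ?thesis using ij refl(2) by (simp add: circulant_index split)
qed

text \<open>A point of the unit circle is extremal in the unit disc.\<close>

lemma unit_convex_combination:
  fixes v :: "'a \<Rightarrow> complex"
  assumes fin: "finite I" and q: "\<And>i. i \<in> I \<Longrightarrow> 0 \<le> q i" "sum q I = 1"
    and v: "\<And>i. i \<in> I \<Longrightarrow> cmod (v i) = 1" and u: "cmod u = 1"
    and comb: "(\<Sum>i\<in>I. complex_of_real (q i) * v i) = u"
    and l: "l \<in> I" "0 < q l"
  shows "v l = u"
proof -
  have uu: "u * cnj u = 1" using u by (rule unit_mult_cnj)
  have le: "Re (v i * cnj u) \<le> 1" if "i \<in> I" for i
    using complex_Re_le_cmod[of "v i * cnj u"] v[OF that] u by (simp add: norm_mult)
  have "(\<Sum>i\<in>I. q i * (1 - Re (v i * cnj u))) = sum q I - Re ((\<Sum>i\<in>I. complex_of_real (q i) * v i) * cnj u)"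
    by (simp add: sum_distrib_right algebra_simps sum_subtractf sum.distrib sum_distrib_left)
  also have "\<dots> = 0" by (simp only: comb uu q) simp
  finally have "\<forall>i\<in>I. q i * (1 - Re (v i * cnj u)) = 0"
    using fin le q(1) by (subst (asm) sum_nonneg_eq_0_iff) auto
  with l have "q l * (1 - Re (v l * cnj u)) = 0" by blast
  then have re: "Re (v l * cnj u) = 1" using l by simp
  have "cmod (v l * cnj u) = 1" using v l u by (simp add: norm_mult)
  then have "v l * cnj u = 1" using re by (simp add: complex_eq_iff cmod_def)
  then have "v l * (u * cnj u) = u" by (simp add: mult_ac)
  then show ?thesis by (simp add: uu)
qed

lemma eq_1_of_powers_Gcd_1:
  fixes z :: "'a::monoid_mult"
  assumes "\<And>n. n \<in> N \<Longrightarrow> 0 < n \<and> z ^ n = 1" "Gcd N = 1"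
  shows "z = 1"
proof -
  have "\<exists>n>0. z ^ n = 1"
  proof -
    have "N \<noteq> {}" using assms(2) by auto
    with assms(1) show ?thesis by blast
  qed
  define d where "d = (LEAST n. 0 < n \<and> z ^ n = 1)"
  have d: "0 < d" "z ^ d = 1"
    using LeastI_ex[OF \<open>\<exists>n>0. z ^ n = 1\<close>] by (simp_all add: d_def)
  have "d dvd n" if "n \<in> N" for n
  proof (rule ccontr)
    assume "\<not> d dvd n"
    then have "0 < n mod d" by (simp add: mod_greater_zero_iff_not_dvd)
    moreover have "z ^ (n mod d) = 1"
      using power_mod_of_power_eq_1[OF d(2)] assms(1)[OF that] by simp
    ultimately have "d \<le> n mod d" unfolding d_def by (intro Least_le) simp
    then show False using mod_less_divisor[OF d(1), of n] by linarith
  qed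
  then have "d dvd Gcd N" by (rule Gcd_greatest)
  then show ?thesis using d assms(2) by simp
qed

lemma jordan_matrix_blocks_1: "jordan_matrix (map (Pair 1) xs) = mat_diag (length xs) ((!) xs)"
proof (induction xs)
  case Nil
  show ?case by (rule eq_matI) (auto simp: jordan_matrix_def mat_diag_def)
next
  case (Cons x xs)
  have s: "sum_list (map (fst \<circ> Pair (Suc 0)) xs) = length xs" by (induction xs) auto
  have "jordan_matrix (map (Pair 1) (x # xs)) = four_block_mat (jordan_block 1 x)
      (0\<^sub>m 1 (length xs)) (0\<^sub>m (length xs) 1) (mat_diag (length xs) ((!) xs))"
    using Cons.IH by (simp add: jordan_matrix_Cons s)
  also have "\<dots> = mat_diag (length (x # xs)) ((!) (x # xs))"
    by (rule eq_matI) (auto simp: mat_diag_def nth_Cons')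
  finally show ?case .
qed

lemma Re_div_one_minus:
  assumes "cmod z < 1"
  shows "0 < 1 + 2 * Re (z / (1 - z))"
proof -
  have ne: "1 - z \<noteq> 0" using assms by auto
  define D where "D = (cmod (1 - z))\<^sup>2"
  have D: "D = 1 - 2 * Re z + (cmod z)\<^sup>2" 
    by (simp add: D_def cmod_power2) (simp add: power2_eq_square algebra_simps)
  have "0 < D" using ne by (simp add: D_def)
  have "z / (1 - z) = inverse (1 - z) - 1" using ne by (simp add: field_simps)
  then have "1 + 2 * Re (z / (1 - z)) = 2 * Re (inverse (1 - z)) - 1" by simp
  also have "Re (inverse (1 - z)) = (1 - Re z) / D" by (simp add: D_def cmod_power2)
  also have "2 * ((1 - Re z) / D) - 1 = (1 - (cmod z)\<^sup>2) / D"
    using \<open>0 < D\<close> by (simp add: field_simps) (simp add: D)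
  also have "\<dots> > 0"
    using assms \<open>0 < D\<close> by (intro divide_pos_pos) (simp_all add: power_less_one_iff)
  finally show ?thesis .
qed

section \<open>Cyclic chains\<close>

lemma pow_mat_nonneg:
  fixes A :: "real mat"
  assumes A: "A \<in> carrier_mat n n" and nonneg: "\<forall>i<n. \<forall>j<n. 0 \<le> A $$ (i,j)"
    and "i < n" "j < n"
  shows "0 \<le> (A ^\<^sub>m k) $$ (i,j)"
  using \<open>j < n\<close>
proof (induction k arbitrary: j)
  case 0
  then show ?case using A \<open>i < n\<close> by simp
next
  case (Suc k)
  have "(A ^\<^sub>m Suc k) $$ (i,j) = (\<Sum>l<n. (A ^\<^sub>m k) $$ (i,l) * A $$ (l,j))"
    using A \<open>i < n\<close> Suc.prems by (simp add: scalar_prod_def lessThan_atLeast0 pow_mat_dim_square)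
  also have "\<dots> \<ge> 0"
    using Suc nonneg by (intro sum_nonneg mult_nonneg_nonneg) auto
  finally show ?case .
qed

locale cyclic_chain =
  fixes m :: nat and a :: "nat \<Rightarrow> real" and P :: "real mat"
  assumes two_le: "2 \<le> m"
    and transition: "transition_matrix m P"
    and irreducible: "irreducible_chain P"
    and aperiodic: "aperiodic_chain P"
    and cyclic: "cyclic_chain_with m a P"
begin

abbreviation \<omega> :: complex where "\<omega> \<equiv> cis (2 * pi / real m)"

abbreviation Q :: "complex mat" where "Q \<equiv> map_mat complex_of_real P"

text \<open>Shifted by one: \<open>lam k\<close> is the paper's \<open>\<lambda>\<close> with index \<open>k + 1\<close>.\<close>

definition lam :: "nat \<Rightarrow> complex" where "lam k = cyclic_lambda m a (Suc k)"

definition mu :: "nat \<Rightarrow> complex" where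
  "mu k = (if k = 0 then -1/2 else lam k / (1 - lam k))"

definition uniform :: "real vec" where "uniform = vec m (\<lambda>_. 1 / real m)"

definition lam_tail :: "complex mat" where "lam_tail = mat_diag (m - 1) (\<lambda>k. lam (Suc k))"

lemma Suc_m: "Suc (m - 1) = m" and m_pos: "0 < m" using two_le by auto

lemma P_carrier: "P \<in> carrier_mat m m"
  and P_nonneg: "\<forall>i<m. \<forall>j<m. 0 \<le> P $$ (i,j)"
  and P_rows: "\<forall>i<m. (\<Sum>j<m. P $$ (i,j)) = 1"
  using transition by (auto simp: transition_matrix_def)

lemma Q_carrier: "Q \<in> carrier_mat m m"
  using P_carrier by simp

lemma lam_eq: "lam k = (\<Sum>d<m. complex_of_real (a (d + 1)) * \<omega> ^ (d * k))"
proof -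
  have "exp (2 * complex_of_real pi * \<i> / of_nat m) = \<omega>"
    by (simp add: cis_conv_exp mult_ac)
  then show ?thesis
    by (simp add: lam_def cyclic_lambda_def sum.atLeast1_atMost_eq)
qed

lemma dft_Q: "dft m * Q = mat_diag m lam * dft m"
proof (rule eq_matI)
  fix k j assume "k < dim_row (mat_diag m lam * dft m)" "j < dim_col (mat_diag m lam * dft m)"
  then have kj: "k < m" "j < m" by (auto simp: mat_diag_def dft_def)
  have period: "\<omega> ^ (k * ((d + j) mod m)) = \<omega> ^ (d * k) * \<omega> ^ (k * j)" for d
  proof -
    have "(\<omega> ^ k) ^ m = (\<omega> ^ m) ^ k" by (simp add: mult.commute flip: power_mult)
    then have "(\<omega> ^ k) ^ m = 1" using m_pos by (simp only: cis_root_power_self power_one)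
    from power_mod_of_power_eq_1[OF this, of "d + j"] show ?thesis
      by (simp add: algebra_simps flip: power_mult power_add)
  qed
  have "(dft m * Q) $$ (k,j) = (\<Sum>i<m. \<omega> ^ (k * i) / of_nat m * complex_of_real (P $$ (i,j)))"
    using kj P_carrier by (simp add: dft_def scalar_prod_def lessThan_atLeast0)
  also have "\<dots> = (\<Sum>d<m. \<omega> ^ (k * ((d + j) mod m)) / of_nat m * complex_of_real (a (d + 1)))"
  proof (rule sum.reindex_bij_witness[of _ "\<lambda>d. (d + j) mod m" "\<lambda>i. nat ((int i - int j) mod int m)"])
    fix i assume "i \<in> {..<m}"
    then have i: "i < m" by simp
    have e: "int (nat ((int i - int j) mod int m)) = (int i - int j) mod int m" using m_pos by simp
    have "int ((nat ((int i - int j) mod int m) + j) mod m) = (int i - int j + int j) mod int m"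
      by (simp only: zmod_int of_nat_add e mod_add_left_eq)
    also have "\<dots> = int i" using i by simp
    finally show inv: "(nat ((int i - int j) mod int m) + j) mod m = i" by simp
    have "(int i - int j) mod int m < int m" using m_pos by simp
    then show "nat ((int i - int j) mod int m) \<in> {..<m}" by (simp add: nat_less_iff m_pos)
    show "\<omega> ^ (k * ((nat ((int i - int j) mod int m) + j) mod m)) / of_nat m
        * complex_of_real (a (nat ((int i - int j) mod int m) + 1))
        = \<omega> ^ (k * i) / of_nat m * complex_of_real (P $$ (i,j))"
      using cyclic i kj by (simp only: inv cyclic_chain_with_def)
  next
    fix d assume "d \<in> {..<m}"
    then have d: "d < m" by simp
    show "(d + j) mod m \<in> {..<m}" using m_pos by simp
    have "(int ((d + j) mod m) - int j) mod int m = int d"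
      using d by (simp add: zmod_int mod_diff_left_eq)
    then show "nat ((int ((d + j) mod m) - int j) mod int m) = d" by simp
  qed
  also have "\<dots> = lam k * (\<omega> ^ (k * j) / of_nat m)"
    unfolding period lam_eq sum_distrib_right by (rule sum.cong) (simp_all add: mult_ac)
  also have "\<dots> = (mat_diag m lam * dft m) $$ (k,j)"
    using kj by (simp add: mat_diag_mult_left[of _ m m] dft_def)
  finally show "(dft m * Q) $$ (k,j) = (mat_diag m lam * dft m) $$ (k,j)" .
qed (use P_carrier in \<open>auto simp: mat_diag_def dft_def\<close>)

lemma Q_eq_circulant: "Q = circulant m lam"
proof -
  have "Q = (idft m * dft m) * Q" using Q_carrier by (simp add: idft_dft)
  also have "\<dots> = idft m * (dft m * Q)" by (rule assoc_mult_mat[OF idft_carrier dft_carrier Q_carrier])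
  also have "\<dots> = idft m * mat_diag m lam * dft m"
    unfolding dft_Q by (rule assoc_mult_mat[symmetric, of _ m m _ m _ m]) simp_all
  finally show ?thesis by (simp add: circulant_def)
qed

lemma lam_0: "lam 0 = 1"
proof -
  have "(Q * idft m) $$ (0,0) = (idft m * mat_diag m lam) $$ (0,0)"
    by (simp only: Q_eq_circulant circulant_idft)
  moreover have "(Q * idft m) $$ (0,0) = complex_of_real (\<Sum>j<m. P $$ (0,j))"
    using P_carrier m_pos by (simp add: idft_def scalar_prod_def lessThan_atLeast0)
  moreover have "(\<Sum>j<m. P $$ (0,j)) = 1" using P_rows m_pos by blast
  ultimately show ?thesis
    using m_pos by (simp add: mat_diag_mult_right[of _ m m] idft_def)
qed

lemma dft_Q_pow: "dft m * Q ^\<^sub>m n = mat_diag m (\<lambda>k. lam k ^ n) * dft m"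
proof (induction n)
  case 0
  show ?case using right_mult_one_mat[OF dft_carrier[of m]] left_mult_one_mat[OF dft_carrier[of m]] P_carrier
    by simp
next
  case (Suc n)
  have Qn: "Q ^\<^sub>m n \<in> carrier_mat m m" using Q_carrier by (rule pow_carrier_mat)
  have "dft m * Q ^\<^sub>m Suc n = dft m * Q ^\<^sub>m n * Q"
    using assoc_mult_mat[OF dft_carrier Qn Q_carrier] by simp
  also have "\<dots> = mat_diag m (\<lambda>k. lam k ^ n) * (dft m * Q)"
    unfolding Suc.IH by (rule assoc_mult_mat[OF mat_diag_dim dft_carrier Q_carrier])
  also have "\<dots> = mat_diag m (\<lambda>k. lam k ^ n) * mat_diag m lam * dft m"
    unfolding dft_Q by (rule assoc_mult_mat[symmetric, of _ m m _ m _ m]) simp_all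
  finally show ?case by (simp add: mult.commute)
qed

lemma pow_eigenvector:
  assumes kj: "k < m" "j < m"
  shows "(\<Sum>i<m. complex_of_real ((P ^\<^sub>m n) $$ (i,j)) * \<omega> ^ (k * i)) = lam k ^ n * \<omega> ^ (k * j)"
proof -
  have Pn: "P ^\<^sub>m n \<in> carrier_mat m m" using P_carrier by (rule pow_carrier_mat)
  have "(dft m * Q ^\<^sub>m n) $$ (k,j) = (\<Sum>i<m. complex_of_real ((P ^\<^sub>m n) $$ (i,j)) * \<omega> ^ (k * i)) / of_nat m"
    using kj carrier_matD[OF Pn] by (simp add: dft_def scalar_prod_def lessThan_atLeast0 sum_divide_distrib mult.commute
        flip: of_real_hom.mat_hom_pow[OF P_carrier])
  moreover have "(dft m * Q ^\<^sub>m n) $$ (k,j) = lam k ^ n * \<omega> ^ (k * j) / of_nat m"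
    unfolding dft_Q_pow using kj by (simp add: mat_diag_mult_left[of _ m m] dft_def)
  ultimately show ?thesis using m_pos by simp
qed

text \<open>The left eigenvector for \<open>\<lambda>\<^sub>0 = 1\<close> is constant, so \<open>P\<close> is doubly stochastic.\<close>

lemma pow_column_sum:
  assumes "j < m"
  shows "(\<Sum>i<m. (P ^\<^sub>m n) $$ (i,j)) = 1"
proof -
  have "complex_of_real (\<Sum>i<m. (P ^\<^sub>m n) $$ (i,j)) = 1"
    using pow_eigenvector[OF m_pos assms, of n] by (simp add: lam_0)
  then show ?thesis by (simp only: of_real_eq_1_iff)
qed

lemma eigenvector_of_unit_eigenvalue:
  assumes k: "k < m" and unit: "cmod (lam k) = 1"
    and l: "l < m" "j < m" "0 < (P ^\<^sub>m n) $$ (l,j)"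
  shows "\<omega> ^ (k * l) = lam k ^ n * \<omega> ^ (k * j)"
  by (rule unit_convex_combination[where I = "{..<m}" and q = "\<lambda>i. (P ^\<^sub>m n) $$ (i,j)"])
    (use assms pow_mat_nonneg[OF P_carrier P_nonneg] pow_column_sum[OF l(2)] pow_eigenvector[OF k l(2)]
      in \<open>auto simp: norm_mult norm_power\<close>)

lemma lam_neq_1:
  assumes "0 < k" "k < m"
  shows "lam k \<noteq> 1"
proof
  assume 1: "lam k = 1"
  have "1 < m" using two_le by simp
  then obtain n where "0 < (P ^\<^sub>m n) $$ (1,0)"
    using irreducible P_carrier m_pos by (auto simp: irreducible_chain_def)
  from eigenvector_of_unit_eigenvalue[OF assms(2) _ \<open>1 < m\<close> m_pos this] 1
  have "\<omega> ^ k = \<omega> ^ 0" by simp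
  then show False using cis_root_power_inj[OF assms(2) m_pos] assms(1) by simp
qed

lemma norm_lam_1: "cmod (lam 1) < 1"
proof -
  have "1 < m" using two_le by simp
  have "cmod (lam 1) \<noteq> 1"
  proof
    assume unit: "cmod (lam 1) = 1"
    let ?N = "{n. 0 < n \<and> 0 < (P ^\<^sub>m n) $$ (0,0)}"
    have "Gcd ?N = 1" using aperiodic P_carrier m_pos by (auto simp: aperiodic_chain_def)
    moreover have "0 < n \<and> lam 1 ^ n = 1" if "n \<in> ?N" for n
      using eigenvector_of_unit_eigenvalue[OF \<open>1 < m\<close> unit m_pos m_pos, of n] that by simp
    ultimately have "lam 1 = 1" by (rule eq_1_of_powers_Gcd_1[rotated])
    then show False using lam_neq_1[of 1] \<open>1 < m\<close> by simp
  qed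
  moreover have "cmod (lam 1) \<le> 1"
  proof -
    have "lam 1 = (\<Sum>i<m. complex_of_real ((P ^\<^sub>m 1) $$ (i,0)) * \<omega> ^ (1 * i))"
      using pow_eigenvector[OF \<open>1 < m\<close> m_pos, of 1] by simp
    also have "cmod \<dots> \<le> (\<Sum>i<m. cmod (complex_of_real ((P ^\<^sub>m 1) $$ (i,0)) * \<omega> ^ (1 * i)))"
      by (rule norm_sum)
    also have "\<dots> = (\<Sum>i<m. (P ^\<^sub>m 1) $$ (i,0))"
      using pow_mat_nonneg[OF P_carrier P_nonneg _ m_pos]
      by (intro sum.cong) (auto simp del: One_nat_def pow_mat.simps simp: norm_mult norm_power)
    finally show ?thesis by (simp only: pow_column_sum[OF m_pos])
  qed
  ultimately show ?thesis by simp
qed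

lemma uniform_carrier: "uniform \<in> carrier_vec m"
  by (simp add: uniform_def)

lemma bordered_lam_tail: "bordered 1 lam_tail = mat_diag m lam"
  by (rule eq_matI) (use Suc_m lam_0 in \<open>auto simp: lam_tail_def mat_diag_def\<close>)

lemma fixed_uniform:
  "\<forall>u\<in>carrier_vec m. transpose_mat Q *\<^sub>v u = u
      \<longrightarrow> (\<exists>c. u = c \<cdot>\<^sub>v map_vec complex_of_real uniform)"
proof (intro ballI impI)
  fix u assume u: "u \<in> carrier_vec m" and fix_u: "transpose_mat Q *\<^sub>v u = u"
  define y where "y = transpose_mat (idft m) *\<^sub>v u"
  have y: "y \<in> carrier_vec m" 
    unfolding y_def by (rule mult_mat_vec_carrier[of _ m m]) (use u in simp_all)
  have "transpose_mat (idft m) *\<^sub>v u = transpose_mat (Q * idft m) *\<^sub>v u"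
    using u fix_u Q_carrier by (simp add: transpose_mult[of _ m m _ m] assoc_mult_mat_vec[of _ m m _ m])
  also have "\<dots> = transpose_mat (idft m * mat_diag m lam) *\<^sub>v u"
    by (simp only: Q_eq_circulant circulant_idft)
  also have "\<dots> = transpose_mat (mat_diag m lam) *\<^sub>v y"
    using u by (simp add: transpose_mult[of _ m m _ m] assoc_mult_mat_vec[of _ m m _ m] y_def)
  also have "transpose_mat (mat_diag m lam) = mat_diag m lam"
    by (rule eq_matI) (auto simp: mat_diag_def)
  finally have y_eq: "y = mat_diag m lam *\<^sub>v y" by (simp add: y_def)
  have y0: "y $ k = 0" if "0 < k" "k < m" for k
  proof -
    have "y $ k = (mat_diag m lam *\<^sub>v y) $ k" using y_eq by simp
    also have "\<dots> = (\<Sum>i<m. (if k = i then lam i else 0) * y $ i)"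
      using that y by (simp add: mat_diag_def scalar_prod_def lessThan_atLeast0)
    also have "\<dots> = (\<Sum>i<m. if i = k then lam k * y $ k else 0)" by (rule sum.cong) auto
    also have "\<dots> = lam k * y $ k" using that by simp
    finally show ?thesis using lam_neq_1[OF that] by simp
  qed
  have "u = transpose_mat (idft m * dft m) *\<^sub>v u"
    using u by (simp add: idft_dft)
  also have "\<dots> = transpose_mat (dft m) *\<^sub>v y"
    using u by (simp add: transpose_mult[of _ m m _ m] assoc_mult_mat_vec[of _ m m _ m] y_def)
  finally have u_eq: "u = transpose_mat (dft m) *\<^sub>v y" .
  have "u = y $ 0 \<cdot>\<^sub>v map_vec complex_of_real uniform"
  proof (rule eq_vecI)
    fix j assume "j < dim_vec (y $ 0 \<cdot>\<^sub>v map_vec complex_of_real uniform)"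
    then have j: "j < m" by (simp add: uniform_def)
    have "u $ j = (\<Sum>k<m. dft m $$ (k,j) * y $ k)"
      using j y by (subst u_eq) (simp add: scalar_prod_def lessThan_atLeast0 carrier_matD[OF dft_carrier])
    also have "\<dots> = (\<Sum>k<m. if k = 0 then y $ 0 / of_nat m else 0)"
      using j y0 by (intro sum.cong) (auto simp: dft_def)
    also have "\<dots> = y $ 0 / of_nat m" using m_pos by simp
    finally show "u $ j = (y $ 0 \<cdot>\<^sub>v map_vec complex_of_real uniform) $ j"
      using j by (simp add: uniform_def)
  qed (use u in \<open>simp add: uniform_def\<close>)
  then show "\<exists>c. u = c \<cdot>\<^sub>v map_vec complex_of_real uniform" by blast
qed

lemma stationary_uniform: "stationary_distribution P uniform"
proof -
  have "transpose_mat P *\<^sub>v uniform = uniform"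
  proof (rule eq_vecI)
    fix j assume "j < dim_vec uniform"
    then have j: "j < m" by (simp add: uniform_def)
    then have "(transpose_mat P *\<^sub>v uniform) $ j = (\<Sum>i<m. P $$ (i,j)) / real m"
      using P_carrier by (simp add: uniform_def scalar_prod_def lessThan_atLeast0 sum_divide_distrib)
    also have "(\<Sum>i<m. P $$ (i,j)) = 1" using pow_column_sum[OF j, of 1] P_carrier by simp
    finally show "(transpose_mat P *\<^sub>v uniform) $ j = uniform $ j" using j by (simp add: uniform_def)
  qed (use P_carrier in \<open>simp add: uniform_def\<close>)
  then show ?thesis
    using P_carrier m_pos by (simp add: stationary_distribution_def uniform_def)
qed

lemma stationary_unique:
  assumes "stationary_distribution P p"
  shows "p = uniform"
proof -
  have p: "p \<in> carrier_vec m" "transpose_mat P *\<^sub>v p = p" "(\<Sum>i<m. p $ i) = 1"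
    using assms P_carrier by (auto simp: stationary_distribution_def)
  have "transpose_mat Q *\<^sub>v map_vec complex_of_real p = map_vec complex_of_real (transpose_mat P *\<^sub>v p)"
    using P_carrier p(1) by (intro eq_vecI) (simp_all add: scalar_prod_def)
  with p fixed_uniform obtain c where c: "map_vec complex_of_real p = c \<cdot>\<^sub>v map_vec complex_of_real uniform"
    by (metis map_carrier_vec)
  have c_eq: "complex_of_real (p $ i) = c / of_nat m" if "i < m" for i
    using arg_cong[OF c, of "\<lambda>v. v $ i"] that p(1) by (simp add: uniform_def)
  have "1 = complex_of_real (\<Sum>i<m. p $ i)" by (simp only: p(3) of_real_1)
  also have "\<dots> = c" using m_pos by (simp add: c_eq)
  finally have "complex_of_real (p $ i) = complex_of_real (1 / real m)" if "i < m" for i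
    using c_eq[OF that] by simp
  then show ?thesis
    using p(1) by (intro eq_vecI) (auto simp: uniform_def simp del: of_real_divide)
qed

lemma fourier_decomposition:
  "chain_jordan_decomposition P uniform (idft m) (dft m) lam_tail"
proof -
  let ?xs = "map (\<lambda>k. lam (Suc k)) [0..<m - 1]"
  have "lam_tail = transpose_mat (mat_diag (length ?xs) ((!) ?xs))"
    by (rule eq_matI) (auto simp: lam_tail_def mat_diag_def)
  then have "lam_tail = transpose_mat (jordan_matrix (map (Pair 1) ?xs))"
    by (simp only: jordan_matrix_blocks_1)
  then have "lower_jordan_matrix lam_tail"
    unfolding lower_jordan_matrix_def by (intro exI[of _ "map (Pair 1) ?xs"]) auto
  moreover have one: "(1\<^sub>m 1 :: complex mat) = mat 1 1 (\<lambda>_. 1)" by (rule eq_matI) auto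
  have "similar_mat_wit Q (block_diag2 (1\<^sub>m 1) lam_tail) (idft m) (dft m)"
    unfolding one bordered_lam_tail
    using Q_carrier by (intro similar_mat_witI[of _ _ m])
      (simp_all add: idft_dft dft_idft Q_eq_circulant circulant_def[symmetric])
  moreover have "row (dft m) 0 = map_vec complex_of_real uniform"
    by (rule eq_vecI) (use m_pos in \<open>auto simp: dft_def uniform_def\<close>)
  ultimately show ?thesis by (simp add: chain_jordan_decomposition_def)
qed

lemma fourier_core: "idft m * cov_core lam_tail * dft m = circulant m mu"
proof -
  note I = decomposition_inverse[of "m - 1" P uniform, unfolded Suc_m, OF transition uniform_carrier
      fourier_decomposition fixed_uniform]
  let ?I = "1\<^sub>m (m - 1) - lam_tail" and ?N = "the (mat_inverse (1\<^sub>m (m - 1) - lam_tail))"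
  let ?D = "mat_diag (m - 1) (\<lambda>k. 1 / (1 - lam (Suc k)))"
  have "?I = mat_diag (m - 1) (\<lambda>k. 1 - lam (Suc k))"
    by (rule eq_matI) (auto simp: lam_tail_def mat_diag_def)
  then have "?I * ?D = mat_diag (m - 1) (\<lambda>k. (1 - lam (Suc k)) * (1 / (1 - lam (Suc k))))" by simp
  also have "\<dots> = 1\<^sub>m (m - 1)"
    by (rule eq_matI) (use lam_neq_1 in \<open>auto simp: mat_diag_def\<close>)
  finally have ID: "?I * ?D = 1\<^sub>m (m - 1)" .
  have "?D = ?N * ?I * ?D" by (simp only: I(4) left_mult_one_mat[OF mat_diag_dim])
  also have "\<dots> = ?N * (?I * ?D)"
    by (rule assoc_mult_mat[OF I(2) minus_carrier_mat[OF I(1)] mat_diag_dim])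
  also have "\<dots> = ?N" using I(2) by (simp only: ID right_mult_one_mat)
  finally have N: "?N = ?D" ..
  have "cov_core lam_tail = mat_diag m mu"
  proof -
    have "lam_tail * ?D = mat_diag (m - 1) (\<lambda>k. mu (Suc k))"
      by (simp add: lam_tail_def mu_def)
    then show ?thesis unfolding I(5) N
      by (intro eq_matI) (use Suc_m in \<open>auto simp: mu_def[of 0] mat_diag_def\<close>)
  qed
  then show ?thesis by (simp add: circulant_def)
qed

lemma core_eq_circulant:
  assumes "stationary_distribution P p" "chain_jordan_decomposition P p T S L"
  shows "T * cov_core L * S = circulant m mu"
proof -
  have "chain_jordan_decomposition P uniform T S L"
    using assms stationary_unique by blast
  from cov_core_unique[of "m - 1" P uniform, unfolded Suc_m, OF transition stationary_uniform
      fixed_uniform this fourier_decomposition]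
  show ?thesis by (simp only: fourier_core)
qed

lemma lam_reflect:
  assumes "k \<le> m"
  shows "lam (m - k) = cnj (lam k)"
proof -
  have "\<omega> ^ (d * (m - k)) = cnj (\<omega> ^ (d * k))" for d
    using root_power_reflect[OF m_pos assms, of d] by (simp add: mult.commute)
  then show ?thesis by (simp add: lam_eq)
qed

lemma mu_reflect: "0 < k \<Longrightarrow> k < m \<Longrightarrow> mu (m - k) = cnj (mu k)"
  by (simp add: mu_def lam_reflect)

lemma circulant_mu_swap:
  assumes "i < m" "j < m"
  shows "circulant m mu $$ (j,i) = circulant m (\<lambda>k. cnj (mu k)) $$ (i,j)"
  using assms by (intro circulant_swap) (simp_all add: mu_reflect mu_def[of 0])

definition covariance :: "real mat" where
  "covariance = mat m m (\<lambda>(i,j). Re (circulant m (\<lambda>k. complex_of_real (1 + 2 * Re (mu k))) $$ (i,j)) / real m)"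

lemma covariance_complex:
  "map_mat complex_of_real covariance = (1 / of_nat m) \<cdot>\<^sub>m circulant m (\<lambda>k. complex_of_real (1 + 2 * Re (mu k)))"
  (is "_ = _ \<cdot>\<^sub>m ?C")
proof (rule eq_matI)
  fix i j assume "i < dim_row ((1 / of_nat m) \<cdot>\<^sub>m ?C)" "j < dim_col ((1 / of_nat m) \<cdot>\<^sub>m ?C)"
  then have ij: "i < m" "j < m" by (simp_all add: carrier_matD[OF circulant_carrier])
  have "cnj (?C $$ (i,j)) = ?C $$ (j,i)"
    using ij by (simp add: cnj_circulant del: of_real_add of_real_mult)
  also have "\<dots> = ?C $$ (i,j)"
    using ij by (intro circulant_swap) (simp_all add: mu_reflect)
  finally have "?C $$ (i,j) = complex_of_real (Re (?C $$ (i,j)))"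
    by (simp add: complex_eq_iff)
  then show "map_mat complex_of_real covariance $$ (i,j) = ((1 / of_nat m) \<cdot>\<^sub>m ?C) $$ (i,j)"
    using ij by (simp add: covariance_def carrier_matD[OF circulant_carrier])
qed (auto simp: covariance_def carrier_matD[OF circulant_carrier])

lemma cov_formula_eq:
  assumes "stationary_distribution P p" "chain_jordan_decomposition P p T S L"
  shows "cov_formula p T S L = map_mat complex_of_real covariance"
proof -
  let ?A = "circulant m mu"
  have "cov_formula p T S L = mat_diag m (\<lambda>_. 1 / of_nat m) + mat_diag m (\<lambda>_. 1 / of_nat m) * ?A
      + transpose_mat ?A * mat_diag m (\<lambda>_. 1 / of_nat m)"
  proof -
    have "mat_diag (dim_vec p) (\<lambda>i. complex_of_real (p $ i)) = mat_diag m (\<lambda>_. 1 / of_nat m)"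
      unfolding stationary_unique[OF assms(1)] by (rule eq_matI) (auto simp: uniform_def mat_diag_def)
    then show ?thesis by (simp only: cov_formula_def Let_def core_eq_circulant[OF assms])
  qed
  also have "\<dots> = map_mat complex_of_real covariance"
    unfolding covariance_complex
  proof (rule eq_matI, goal_cases)
    case (1 i j)
    then have ij: "i < m" "j < m" by (simp_all add: carrier_matD[OF circulant_carrier])
    have "circulant m (\<lambda>k. complex_of_real (1 + 2 * Re (mu k))) $$ (i,j)
        = circulant m (\<lambda>_. 1) $$ (i,j) + ?A $$ (i,j) + circulant m (\<lambda>k. cnj (mu k)) $$ (i,j)"
    proof -
      have "complex_of_real (1 + 2 * Re (mu k)) = 1 + mu k + cnj (mu k)" for k
        by (simp add: complex_eq_iff)
      then show ?thesis
        unfolding circulant_index[OF ij] by (simp add: algebra_simps sum.distrib add_divide_distrib)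
    qed
    also have "\<dots> = 1\<^sub>m m $$ (i,j) + ?A $$ (i,j) + ?A $$ (j,i)"
      by (simp only: circulant_one circulant_mu_swap[OF ij])
    finally show ?case
      using ij by (simp add: carrier_matD[OF circulant_carrier] mat_diag_mult_left[of _ m m]
          mat_diag_mult_right[of _ m m] add_divide_distrib) (simp add: mat_diag_def)
  qed (simp_all add: carrier_matD[OF circulant_carrier] mat_diag_def)
  finally show ?thesis .
qed

lemma asymptotic_covariance_eq: "asymptotic_covariance P = covariance"
  unfolding asymptotic_covariance_def
proof (rule the_equality)
  show "\<exists>p T S L. stationary_distribution P p \<and> chain_jordan_decomposition P p T S L \<and>
      map_mat complex_of_real covariance = cov_formula p T S L"
    using stationary_uniform fourier_decomposition
      cov_formula_eq[OF stationary_uniform fourier_decomposition] by metis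
next
  fix Sig assume "\<exists>p T S L. stationary_distribution P p \<and> chain_jordan_decomposition P p T S L \<and>
      map_mat complex_of_real Sig = cov_formula p T S L"
  then have "map_mat complex_of_real Sig = map_mat complex_of_real covariance"
    using cov_formula_eq by metis
  then show "Sig = covariance" by (rule of_real_hom.mat_hom_inj)
qed

lemma Sigma_iidu_complex:
  "map_mat complex_of_real (c \<cdot>\<^sub>m Sigma_iidu m)
    = (1 / of_nat m) \<cdot>\<^sub>m circulant m (\<lambda>k. if k = 0 then 0 else complex_of_real c)"
  (is "_ = _ \<cdot>\<^sub>m circulant m ?g")
proof (rule eq_matI)
  fix i j
  assume "i < dim_row ((1 / of_nat m) \<cdot>\<^sub>m circulant m ?g)" "j < dim_col ((1 / of_nat m) \<cdot>\<^sub>m circulant m ?g)"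
  then have ij: "i < m" "j < m" by (simp_all add: carrier_matD[OF circulant_carrier])
  let ?e = "\<lambda>k. \<omega> ^ (k * j) * cnj (\<omega> ^ (k * i))"
  have "(\<Sum>k<m. ?g k * ?e k) = (\<Sum>k<m. complex_of_real c * ?e k - (if k = 0 then complex_of_real c else 0))"
    by (rule sum.cong) auto
  also have "\<dots> = complex_of_real c * (\<Sum>k<m. 1 * ?e k) - complex_of_real c"
    using m_pos by (simp add: sum_subtractf sum_distrib_left)
  finally have S: "(\<Sum>k<m. ?g k * ?e k) = complex_of_real c * (\<Sum>k<m. 1 * ?e k) - complex_of_real c" .
  have "circulant m ?g $$ (i,j) = complex_of_real c * (circulant m (\<lambda>_. 1) $$ (i,j) - 1 / of_nat m)"
    unfolding circulant_index[OF ij] S by (simp add: right_diff_distrib diff_divide_distrib)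
  also have "\<dots> = complex_of_real (c * ((if i = j then 1 else 0) - 1 / real m))"
    using ij by (simp add: circulant_one)
  finally have C: "circulant m ?g $$ (i,j) = complex_of_real (c * ((if i = j then 1 else 0) - 1 / real m))" .
  have "real m - 1 \<noteq> 0" using two_le by simp
  then have "Sigma_iidu m $$ (i,j) = ((if i = j then 1 else 0) - 1 / real m) / real m"
    using ij m_pos by (simp add: Sigma_iidu_def M1_def field_simps power2_eq_square)
  then show "map_mat complex_of_real (c \<cdot>\<^sub>m Sigma_iidu m) $$ (i,j)
      = ((1 / of_nat m) \<cdot>\<^sub>m circulant m ?g) $$ (i,j)"
    using ij by (simp add: C Sigma_iidu_def M1_def carrier_matD[OF circulant_carrier])
qed (simp_all add: Sigma_iidu_def M1_def carrier_matD[OF circulant_carrier])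

lemma covariance_multiple_iff:
  "asymptotic_covariance P = c \<cdot>\<^sub>m Sigma_iidu m \<longleftrightarrow> (\<forall>k. 0 < k \<and> k < m \<longrightarrow> 1 + 2 * Re (mu k) = c)"
proof
  assume "asymptotic_covariance P = c \<cdot>\<^sub>m Sigma_iidu m"
  then have "of_nat m \<cdot>\<^sub>m map_mat complex_of_real covariance = of_nat m \<cdot>\<^sub>m map_mat complex_of_real (c \<cdot>\<^sub>m Sigma_iidu m)"
    by (simp add: asymptotic_covariance_eq)
  moreover have "of_nat m \<cdot>\<^sub>m ((1 / of_nat m) \<cdot>\<^sub>m X) = X" for X :: "complex mat"
    using m_pos by (intro eq_matI) auto
  ultimately have "circulant m (\<lambda>k. complex_of_real (1 + 2 * Re (mu k)))
      = circulant m (\<lambda>k. if k = 0 then 0 else complex_of_real c)"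
    by (simp only: covariance_complex Sigma_iidu_complex)
  note eq = circulant_inj[OF this]
  show "\<forall>k. 0 < k \<and> k < m \<longrightarrow> 1 + 2 * Re (mu k) = c"
  proof (intro allI impI)
    fix k assume "0 < k \<and> k < m"
    with eq[of k] have "complex_of_real (1 + 2 * Re (mu k)) = complex_of_real c" by simp
    then show "1 + 2 * Re (mu k) = c" by (simp only: of_real_eq_iff)
  qed
next
  assume *: "\<forall>k. 0 < k \<and> k < m \<longrightarrow> 1 + 2 * Re (mu k) = c"
  have "circulant m (\<lambda>k. complex_of_real (1 + 2 * Re (mu k)))
      = circulant m (\<lambda>k. if k = 0 then 0 else complex_of_real c)"
    by (rule circulant_cong) (use * in \<open>auto simp: mu_def simp del: of_real_add of_real_mult\<close>)
  then have "map_mat complex_of_real covariance = map_mat complex_of_real (c \<cdot>\<^sub>m Sigma_iidu m)"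
    by (simp only: covariance_complex Sigma_iidu_complex)
  then show "asymptotic_covariance P = c \<cdot>\<^sub>m Sigma_iidu m"
    unfolding asymptotic_covariance_eq by (rule of_real_hom.mat_hom_inj)
qed

lemma Re_mu_const_iff:
  "(\<forall>j\<in>{2..m}. Re (cyclic_lambda m a j / (1 - cyclic_lambda m a j)) = \<gamma>)
    \<longleftrightarrow> (\<forall>k. 0 < k \<and> k < m \<longrightarrow> Re (mu k) = \<gamma>)"
proof -
  have "(\<forall>j\<in>{2..m}. F j) \<longleftrightarrow> (\<forall>k. 0 < k \<and> k < m \<longrightarrow> F (Suc k))" for F :: "nat \<Rightarrow> bool"
  proof (intro iffI ballI)
    fix j assume "\<forall>k. 0 < k \<and> k < m \<longrightarrow> F (Suc k)" "j \<in> {2..m}"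
    then show "F j" by (cases j) auto
  qed auto
  then show ?thesis by (simp add: mu_def lam_def)
qed

lemma scale_pos:
  assumes "\<forall>k. 0 < k \<and> k < m \<longrightarrow> Re (mu k) = \<gamma>"
  shows "0 < 1 + 2 * \<gamma>"
proof -
  have "Re (mu 1) = \<gamma>" using assms two_le by simp
  then show ?thesis using Re_div_one_minus[OF norm_lam_1] by (simp add: mu_def)
qed

end

theorem theorem4p2:
  fixes m :: nat and a :: "nat \<Rightarrow> real" and P :: "real mat"
  assumes "2 \<le> m"
    and "transition_matrix m P"
    and "irreducible_chain P"
    and "aperiodic_chain P"
    and "cyclic_chain_with m a P"
  shows "((\<exists>c>0. asymptotic_covariance P = c \<cdot>\<^sub>m Sigma_iidu m) \<longleftrightarrow>
          (\<exists>\<gamma>::real. \<forall>j\<in>{2..m}. Re (cyclic_lambda m a j / (1 - cyclic_lambda m a j)) = \<gamma>)) \<and>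
         (\<forall>\<gamma>::real. (\<forall>j\<in>{2..m}. Re (cyclic_lambda m a j / (1 - cyclic_lambda m a j)) = \<gamma>) \<longrightarrow>
            asymptotic_covariance P = (1 + 2 * \<gamma>) \<cdot>\<^sub>m Sigma_iidu m)"
proof -
  interpret cyclic_chain m a P
    using assms by unfold_locales
  show ?thesis
    unfolding Re_mu_const_iff
  proof (intro conjI iffI allI impI)
    assume "\<exists>c>0. asymptotic_covariance P = c \<cdot>\<^sub>m Sigma_iidu m"
    then obtain c where "\<forall>k. 0 < k \<and> k < m \<longrightarrow> 1 + 2 * Re (mu k) = c"
      by (auto simp: covariance_multiple_iff)
    then have "\<forall>k. 0 < k \<and> k < m \<longrightarrow> Re (mu k) = (c - 1) / 2" by (auto simp: field_simps)
    then show "\<exists>\<gamma>. \<forall>k. 0 < k \<and> k < m \<longrightarrow> Re (mu k) = \<gamma>" by blast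
  next
    assume "\<exists>\<gamma>. \<forall>k. 0 < k \<and> k < m \<longrightarrow> Re (mu k) = \<gamma>"
    then obtain \<gamma> where \<gamma>: "\<forall>k. 0 < k \<and> k < m \<longrightarrow> Re (mu k) = \<gamma>" by blast
    then have "asymptotic_covariance P = (1 + 2 * \<gamma>) \<cdot>\<^sub>m Sigma_iidu m"
      by (simp add: covariance_multiple_iff)
    with scale_pos[OF \<gamma>] show "\<exists>c>0. asymptotic_covariance P = c \<cdot>\<^sub>m Sigma_iidu m" by blast
  next
    fix \<gamma> assume "\<forall>k. 0 < k \<and> k < m \<longrightarrow> Re (mu k) = \<gamma>"
    then show "asymptotic_covariance P = (1 + 2 * \<gamma>) \<cdot>\<^sub>m Sigma_iidu m"
      by (simp add: covariance_multiple_iff)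
  qed
qed

end
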